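(* Let $G$ be a first countable Hausdorff topological group, let $H$ be a dense countable subgroup of $G$, let $(X,d)$ be a compact metric space, and let $\Phi\in\operatorname{Act}(G,X)$. Then the following statements are true: (1) $P(\Phi)=\{x\in X\mid m_x\in\mathsf{M}_P(\Phi)\}$, where $m_x$ is the Dirac measure at $x$. (2) If $k\in\mathbb{N}$, $\{\mu_1,\ldots,\mu_k\}\subseteq\mathsf{M}_P(\Phi)$ and $t_1,\ldots,t_k\in(0,1]$ satisfy $\sum_{i=1}^k t_i=1$, then $\sum_{i=1}^k t_i\mu_i\in\mathsf{M}_P(\Phi)$.
   Context: $\operatorname{Act}(G,X)$ denotes the set of all continuous maps $\Phi:G\times X\to X$ such that, writing $\Phi_g=\Phi(g,\cdot)$, each $\Phi_g$ is a homeomorphism of $X$, $\Phi_e=\mathrm{id}_X$ for the identity $e\in G$, and $\Phi_g\circ\Phi_h=\Phi_{gh}$ for all $g,h\in G$. For $\Phi,\Psi\in\operatorname{Act}(G,X)$ put $d_H(\Phi,\Psi)=\sup_{h\in H,\,x\in X} d(\Phi_h(x),\Psi_h(x))$. A point $x\in X$ is a $\beta$-persistent point of $\Phi$ (with respect to $H$) if for each $\epsilon>0$ there is $\delta>0$ such that for each $\Psi\in\operatorname{Act}(G,X)$ with $d_H(\Phi,\Psi)\le\delta$ there is $y\in X$ with $d(\Phi_g(x),\Psi_g(y))\le\epsilon$ for each $g\in G$. $P(\Phi)$ is the set of all $\beta$-persistent points of $\Phi$. For $\epsilon>0$ and $x\in X$ let $\Gamma_\epsilon^x(\Phi,\Psi)=\{y\in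 X\mid d(\Phi_g(x),\Psi_g(y))\le\epsilon\text{ for each }g\in G\}$ and $B(\epsilon,\Phi,\Psi)=\{x\in X\mid\Gamma_\epsilon^x(\Phi,\Psi)\ne\emptyset\}$ (a closed subset of $X$). $\mathcal{M}(X)$ is the set of Borel probability measures on $X$. A measure $\mu\in\mathcal{M}(X)$ is a $\beta$-persistent measure (with respect to $H$ and $\Phi$) if for each $\epsilon>0$ there is $\delta>0$ such that $\mu(B(\epsilon,\Phi,\Psi))=1$ for each $\Psi\in\operatorname{Act}(G,X)$ with $d_H(\Phi,\Psi)\le\delta$. $\mathsf{M}_P(\Phi)$ is the set of all $\beta$-persistent measures. *)

theory Defs
  imports "HOL-Probability.Probability"
begin

text \<open>
  The group \<open>G\<close> is a type of class \<^class>\<open>topological_group_add\<close>. This class is not commutative;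
  its operations are written additively, so that \<open>g + h\<close>, \<open>0\<close> and \<open>- g\<close> stand for \<open>gh\<close>, \<open>e\<close> and
  the inverse of \<open>g\<close>. Maps \<open>G \<times> X \<rightarrow> X\<close> are curried.
\<close>

definition is_subgroup :: "'g::group_add set \<Rightarrow> bool" where
  "is_subgroup H \<longleftrightarrow> 0 \<in> H \<and> (\<forall>g\<in>H. \<forall>h\<in>H. g + h \<in> H) \<and> (\<forall>g\<in>H. - g \<in> H)"

definition Act :: "('g::topological_group_add \<Rightarrow> 'x::metric_space \<Rightarrow> 'x) set" where
  "Act = {\<Phi>. continuous_on UNIV (\<lambda>(g, x). \<Phi> g x)
            \<and> (\<forall>g. \<exists>f. homeomorphism UNIV UNIV (\<Phi> g) f)
            \<and> \<Phi> 0 = id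
            \<and> (\<forall>g h. \<Phi> g \<circ> \<Phi> h = \<Phi> (g + h))}"

text \<open>
  A real supremum: it is the intended one whenever \<open>H\<close> is nonempty and \<open>X\<close> is bounded (in
  particular, compact).
\<close>

definition act_dist ::
    "'g set \<Rightarrow> ('g \<Rightarrow> 'x::metric_space \<Rightarrow> 'x) \<Rightarrow> ('g \<Rightarrow> 'x \<Rightarrow> 'x) \<Rightarrow> real" where
  "act_dist H \<Phi> \<Psi> = (SUP (h, x)\<in>H \<times> UNIV. dist (\<Phi> h x) (\<Psi> h x))"

definition persistent_point ::
    "'g::topological_group_add set \<Rightarrow> ('g \<Rightarrow> 'x::metric_space \<Rightarrow> 'x) \<Rightarrow> 'x \<Rightarrow> bool" where
  "persistent_point H \<Phi> x \<longleftrightarrow>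
     (\<forall>\<epsilon>>0. \<exists>\<delta>>0. \<forall>\<Psi>\<in>Act. act_dist H \<Phi> \<Psi> \<le> \<delta> \<longrightarrow>
        (\<exists>y. \<forall>g. dist (\<Phi> g x) (\<Psi> g y) \<le> \<epsilon>))"

definition persistent_points ::
    "'g::topological_group_add set \<Rightarrow> ('g \<Rightarrow> 'x::metric_space \<Rightarrow> 'x) \<Rightarrow> 'x set" where
  "persistent_points H \<Phi> = {x. persistent_point H \<Phi> x}"

definition Gamma_set ::
    "real \<Rightarrow> 'x::metric_space \<Rightarrow> ('g \<Rightarrow> 'x \<Rightarrow> 'x) \<Rightarrow> ('g \<Rightarrow> 'x \<Rightarrow> 'x) \<Rightarrow> 'x set" where
  "Gamma_set \<epsilon> x \<Phi> \<Psi> = {y. \<forall>g. dist (\<Phi> g x) (\<Psi> g y) \<le> \<epsilon>}"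

definition B_set ::
    "real \<Rightarrow> ('g \<Rightarrow> 'x::metric_space \<Rightarrow> 'x) \<Rightarrow> ('g \<Rightarrow> 'x \<Rightarrow> 'x) \<Rightarrow> 'x set" where
  "B_set \<epsilon> \<Phi> \<Psi> = {x. Gamma_set \<epsilon> x \<Phi> \<Psi> \<noteq> {}}"

definition borel_prob_measures :: "'x::topological_space measure set" where
  "borel_prob_measures = {\<mu>. sets \<mu> = sets borel \<and> prob_space \<mu>}"

definition persistent_measures ::
    "'g::topological_group_add set \<Rightarrow> ('g \<Rightarrow> 'x::metric_space \<Rightarrow> 'x) \<Rightarrow> 'x measure set" where
  "persistent_measures H \<Phi> =
     {\<mu> \<in> borel_prob_measures.
        \<forall>\<epsilon>>0. \<exists>\<delta>>0. \<forall>\<Psi>\<in>Act. act_dist H \<Phi> \<Psi> \<le> \<delta> \<longrightarrow> emeasure \<mu> (B_set \<epsilon> \<Phi> \<Psi>) = 1}"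

text \<open>The library has no sum of measures; \<open>emeasure_measure_comb\<close> below confirms the definition.\<close>

definition measure_comb ::
    "'i set \<Rightarrow> ('i \<Rightarrow> real) \<Rightarrow> ('i \<Rightarrow> 'x::topological_space measure) \<Rightarrow> 'x measure" where
  "measure_comb I t \<mu> =
     measure_of UNIV (sets borel) (\<lambda>A. \<Sum>i\<in>I. ennreal (t i) * emeasure (\<mu> i) A)"

lemma sets_measure_comb [simp]: "sets (measure_comb I t \<mu>) = sets borel"
  unfolding measure_comb_def
  by (metis sets.sets_measure_of_eq space_borel)

lemma emeasure_measure_comb:
  fixes \<mu> :: "'i \<Rightarrow> 'x::topological_space measure"
  assumes "\<And>i. i \<in> I \<Longrightarrow> sets (\<mu> i) = sets borel" and "A \<in> sets borel"
  shows "emeasure (measure_comb I t \<mu>) A = (\<Sum>i\<in>I. ennreal (t i) * emeasure (\<mu> i) A)"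
proof (rule emeasure_measure_of[OF measure_comb_def])
  let ?f = "\<lambda>A. \<Sum>i\<in>I. ennreal (t i) * emeasure (\<mu> i) A"
  show "sets (borel :: 'x measure) \<subseteq> Pow UNIV" by simp
  show "A \<in> sets (measure_comb I t \<mu>)" using assms(2) by simp
  show "positive (sets (measure_comb I t \<mu>)) ?f" by (simp add: positive_def)
  show "countably_additive (sets (measure_comb I t \<mu>)) ?f"
  proof (rule countably_additiveI)
    fix F :: "nat \<Rightarrow> 'x set"
    assume F: "range F \<subseteq> sets (measure_comb I t \<mu>)" "disjoint_family F"
    have "(\<Sum>n. ?f (F n)) = (\<Sum>i\<in>I. \<Sum>n. ennreal (t i) * emeasure (\<mu> i) (F n))"
      by (rule suminf_sum) simp
    also have "\<dots> = (\<Sum>i\<in>I. ennreal (t i) * emeasure (\<mu> i) (\<Union>n. F n))"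
      using F assms(1) by (intro sum.cong refl) (simp add: ennreal_suminf_cmult suminf_emeasure)
    finally show "(\<Sum>n. ?f (F n)) = ?f (\<Union>n. F n)" .
  qed
qed

end

theory Submission
  imports Defs
begin

text \<open>
  The measure condition makes sense because \<open>B(\<epsilon>,\<Phi>,\<Psi>)\<close> is closed: it is the projection to the
  first factor of a closed, hence compact, subset of \<open>X \<times> X\<close>. For a Dirac measure it then says
  that the point lies in \<open>B(\<epsilon>,\<Phi>,\<Psi>)\<close>; for a convex combination the smallest of the finitely many
  \<open>\<delta>\<close> works.
\<close>

text \<open>Continuity in x for a fixed group element comes from the homeomorphism clause of
  \<open>Act\<close>; this is the form in which \<open>closed_B_set\<close> uses it.\<close>

lemma Act_continuous_on:
  assumes "\<Phi> \<in> Act"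
  shows "continuous_on S (\<Phi> g)"
proof -
  obtain f where "homeomorphism UNIV UNIV (\<Phi> g) f"
    using assms unfolding Act_def by blast
  then show ?thesis
    using continuous_on_subset[OF homeomorphism_cont1] by blast
qed

lemma closed_B_set:
  fixes \<Phi> \<Psi> :: "'g::topological_group_add \<Rightarrow> 'x::metric_space \<Rightarrow> 'x"
  assumes "compact (UNIV :: 'x set)" and \<Phi>: "\<Phi> \<in> Act" and \<Psi>: "\<Psi> \<in> Act"
  shows "closed (B_set \<epsilon> \<Phi> \<Psi>)"
proof -
  let ?R = "{p :: 'x \<times> 'x. \<forall>g. dist (\<Phi> g (fst p)) (\<Psi> g (snd p)) \<le> \<epsilon>}"
  have "continuous_on UNIV (\<lambda>p :: 'x \<times> 'x. dist (\<Phi> g (fst p)) (\<Psi> g (snd p)))" for g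
    by (intro continuous_on_dist
        continuous_on_compose2[OF Act_continuous_on[OF \<Phi>, of UNIV g]]
        continuous_on_compose2[OF Act_continuous_on[OF \<Psi>, of UNIV g]]
        continuous_on_fst continuous_on_snd continuous_on_id) auto
  \<comment> \<open>An arbitrary intersection over g of closed sets; the non-strict inequality makes
    each of them closed.\<close>
  then have "closed ?R"
    by (intro closed_Collect_all closed_Collect_le) auto
  \<comment> \<open>A projection need not preserve closedness, but it does preserve compactness,
    which \<open>?R\<close> inherits from the product.\<close>
  moreover have "compact (UNIV :: ('x \<times> 'x) set)"
    using compact_Times[OF assms(1) assms(1)] by simp
  ultimately have "compact ?R"
    using compact_Int_closed[of UNIV ?R] by simp
  then have "compact (fst ` ?R)"
    by (intro compact_continuous_image continuous_on_fst continuous_on_id)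
  moreover have "fst ` ?R = B_set \<epsilon> \<Phi> \<Psi>"
    by (auto simp: B_set_def Gamma_set_def image_iff) (rule exI)
  ultimately show ?thesis
    using compact_imp_closed by metis
qed

lemma persistent_point_iff_return:
  fixes \<Phi> :: "'g::topological_group_add \<Rightarrow> 'x::metric_space \<Rightarrow> 'x"
  assumes "compact (UNIV :: 'x set)" and "\<Phi> \<in> Act"
  shows "persistent_point H \<Phi> x \<longleftrightarrow> return borel x \<in> persistent_measures H \<Phi>"
proof -
  have "return borel x \<in> borel_prob_measures"
    by (simp add: borel_prob_measures_def prob_space_return)
  \<comment> \<open>The equivalence holds for each fixed \<epsilon> and \<Psi>, so the same \<delta>
    serves in both directions. Since \<open>B_set\<close> is Borel, the Dirac measure of it is its
    indicator at x, hence 0 or 1.\<close>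
  moreover have "emeasure (return borel x) (B_set \<epsilon> \<Phi> \<Psi>) = 1
      \<longleftrightarrow> (\<exists>y. \<forall>g. dist (\<Phi> g x) (\<Psi> g y) \<le> \<epsilon>)" if "\<Psi> \<in> Act" for \<epsilon> \<Psi>
    using closed_B_set[OF assms that]
    by (auto simp: borel_closed indicator_def B_set_def Gamma_set_def)
  ultimately show ?thesis
    by (simp add: persistent_point_def persistent_measures_def)
qed

text \<open>The sum collapses to the total weight. Nonnegativity lets \<open>ennreal\<close> commute
  with the sum, as it sends negative reals to 0. Taking A to be \<open>UNIV\<close> gives total mass
  1, and taking A to be \<open>B_set\<close> gives persistence.\<close>

lemma emeasure_measure_comb_eq_1:
  fixes \<mu> :: "'i \<Rightarrow> 'x::topological_space measure"
  assumes "\<And>i. i \<in> I \<Longrightarrow> sets (\<mu> i) = sets borel" and "A \<in> sets borel"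
    and "\<And>i. i \<in> I \<Longrightarrow> emeasure (\<mu> i) A = 1"
    and "\<And>i. i \<in> I \<Longrightarrow> 0 \<le> t i" and "(\<Sum>i\<in>I. t i) = 1"
  shows "emeasure (measure_comb I t \<mu>) A = 1"
  using assms by (simp add: emeasure_measure_comb)

lemma measure_comb_borel_prob:
  fixes \<mu> :: "'i \<Rightarrow> 'x::topological_space measure"
  assumes "\<mu> ` I \<subseteq> borel_prob_measures"
    and "\<And>i. i \<in> I \<Longrightarrow> 0 \<le> t i" and "(\<Sum>i\<in>I. t i) = 1"
  shows "measure_comb I t \<mu> \<in> borel_prob_measures"
proof -
  have sets: "sets (\<mu> i) = sets borel" and prob: "prob_space (\<mu> i)" if "i \<in> I" for i
    using assms(1) that by (auto simp: borel_prob_measures_def)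
  \<comment> \<open>\<open>prob_space\<close> speaks of the mass of \<open>space (\<mu> i)\<close>;
    equality of the sigma-algebras identifies this space with \<open>UNIV\<close>.\<close>
  have "emeasure (\<mu> i) UNIV = 1" if "i \<in> I" for i
    using prob_space.emeasure_space_1[OF prob[OF that]] sets_eq_imp_space_eq[OF sets[OF that]]
    by simp
  then have "emeasure (measure_comb I t \<mu>) UNIV = 1"
    using sets assms(2,3) by (intro emeasure_measure_comb_eq_1) auto
  moreover have "space (measure_comb I t \<mu>) = UNIV"
    using sets_eq_imp_space_eq[OF sets_measure_comb] by simp
  ultimately show ?thesis
    by (auto simp: borel_prob_measures_def intro: prob_spaceI)
qed

lemma measure_comb_persistent:
  fixes \<Phi> :: "'g::topological_group_add \<Rightarrow> 'x::metric_space \<Rightarrow> 'x"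
  assumes "compact (UNIV :: 'x set)" and "\<Phi> \<in> Act"
    and \<mu>: "\<mu> ` I \<subseteq> persistent_measures H \<Phi>"
    and t: "\<And>i. i \<in> I \<Longrightarrow> 0 \<le> t i" "(\<Sum>i\<in>I. t i) = 1"
  shows "measure_comb I t \<mu> \<in> persistent_measures H \<Phi>"
proof -
  \<comment> \<open>Sums over infinite or empty index sets are 0 by convention, so total weight 1
    excludes both. This makes the minimum of the \<open>\<delta> i\<close> meaningful and
    positive.\<close>
  have I: "finite I" "I \<noteq> {}"
    using t(2) by (auto intro: ccontr)
  have prob: "\<mu> ` I \<subseteq> borel_prob_measures"
    using \<mu> by (auto simp: persistent_measures_def)
  have "\<exists>\<delta>>0. \<forall>\<Psi>\<in>Act. act_dist H \<Phi> \<Psi> \<le> \<delta> \<longrightarrow>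
      emeasure (measure_comb I t \<mu>) (B_set \<epsilon> \<Phi> \<Psi>) = 1" if "\<epsilon> > 0" for \<epsilon>
  proof -
    have "\<forall>i\<in>I. \<exists>\<delta>>0. \<forall>\<Psi>\<in>Act. act_dist H \<Phi> \<Psi> \<le> \<delta> \<longrightarrow> emeasure (\<mu> i) (B_set \<epsilon> \<Phi> \<Psi>) = 1"
      using \<mu> \<open>\<epsilon> > 0\<close> by (auto simp: persistent_measures_def)
    then obtain \<delta> where \<delta>: "\<And>i. i \<in> I \<Longrightarrow> \<delta> i > 0"
      "\<And>i \<Psi>. i \<in> I \<Longrightarrow> \<Psi> \<in> Act \<Longrightarrow> act_dist H \<Phi> \<Psi> \<le> \<delta> i
        \<Longrightarrow> emeasure (\<mu> i) (B_set \<epsilon> \<Phi> \<Psi>) = 1"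
      by metis
    show ?thesis
    proof (intro exI[of _ "Min (\<delta> ` I)"] conjI ballI impI)
      show "Min (\<delta> ` I) > 0"
        using I \<delta>(1) by simp
      fix \<Psi> :: "'g \<Rightarrow> 'x \<Rightarrow> 'x"
      assume \<Psi>: "\<Psi> \<in> Act" "act_dist H \<Phi> \<Psi> \<le> Min (\<delta> ` I)"
      show "emeasure (measure_comb I t \<mu>) (B_set \<epsilon> \<Phi> \<Psi>) = 1"
      proof (rule emeasure_measure_comb_eq_1)
        show "B_set \<epsilon> \<Phi> \<Psi> \<in> sets borel"
          by (intro borel_closed closed_B_set assms(1,2) \<Psi>(1))
        show "emeasure (\<mu> i) (B_set \<epsilon> \<Phi> \<Psi>) = 1" if "i \<in> I" for i
          using \<Psi> \<delta>(2) I that by simp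
      qed (use prob t in \<open>auto simp: borel_prob_measures_def\<close>)
    qed
  qed
  then show ?thesis
    using measure_comb_borel_prob[OF prob t] by (simp add: persistent_measures_def)
qed

theorem theorem3p15:
  fixes H :: "'g::{topological_group_add, t2_space, first_countable_topology} set"
    and \<Phi> :: "'g \<Rightarrow> 'x::metric_space \<Rightarrow> 'x"
  assumes "is_subgroup H" and "countable H" and "closure H = UNIV"
    and "compact (UNIV :: 'x set)"
    and "\<Phi> \<in> Act"
  shows "persistent_points H \<Phi> = {x. return borel x \<in> persistent_measures H \<Phi>}
    \<and> (\<forall>(k::nat) \<mu> t.
         \<mu> ` {1..k} \<subseteq> persistent_measures H \<Phi>
         \<and> (\<forall>i\<in>{1..k}. 0 < t i \<and> t i \<le> 1) \<and> (\<Sum>i=1..k. t i) = 1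
         \<longrightarrow> measure_comb {1..k} t \<mu> \<in> persistent_measures H \<Phi>)"
proof (intro conjI allI impI; (elim conjE)?)
  show "persistent_points H \<Phi> = {x. return borel x \<in> persistent_measures H \<Phi>}"
    using persistent_point_iff_return[OF assms(4,5)] by (simp add: persistent_points_def)
next
  fix k :: nat and \<mu> :: "nat \<Rightarrow> 'x measure" and t :: "nat \<Rightarrow> real"
  assume "\<mu> ` {1..k} \<subseteq> persistent_measures H \<Phi>" "\<forall>i\<in>{1..k}. 0 < t i \<and> t i \<le> 1"
    "(\<Sum>i=1..k. t i) = 1"
  \<comment> \<open>The case k = 0 is vacuous: the empty sum of weights is 0, not 1.\<close>
  then show "measure_comb {1..k} t \<mu> \<in> persistent_measures H \<Phi>"
    using assms(4,5) by (intro measure_comb_persistent) (auto simp: less_imp_le)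
qed

end
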